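(* Let $\delta,a,K\in\mathbb{N}$ satisfy $2\le a\le K-2$, let $f$ be a bistable reaction function with viability constant $a$ and capacity $K$, and let $F$ be the update rule of the bistable reaction-diffusion cellular automaton determined by $\delta$ and $f$. If $\delta=1$, then (1) there are no moving traveling waves, i.e. there is no wave profile $w$ and no integer $c\ne 0$ with $F(w)_n=w_{n-c}$ for all $n\in\mathbb{Z}$; (2) there exists a pinned traveling wave, i.e. a wave profile $w$ with $F(w)=w$.
   Context: $\mathbb{N}=\{1,2,\dots\}$, $\mathbb{N}_0=\mathbb{N}\cup\{0\}$; a subscript $\mathbb{Z}$ on an interval denotes its intersection with $\mathbb{Z}$, e.g. $(0,a)_{\mathbb{Z}}=(0,a)\cap\mathbb{Z}$. For $\delta\in\mathbb{N}$ define $h_\delta(m,n)\in\mathbb{Z}$ for $m,n\in\mathbb{N}_0$ by: $h_\delta(m,n)=\delta$ if $m-n\ge 2\delta$; $h_\delta(m,n)=-\delta$ if $m-n\le -2\delta$; for $j=1,\dots,\delta-1$, $h_\delta(m,n)=j$ if $m-n\in\{2j,2j+1\}$ and $h_\delta(m,n)=-j$ if $n-m\in\{2j,2j+1\}$; and $h_\delta(m,n)=0$ otherwise. For integers $a,K$ with $2\le a\le K-2$, a bistable reaction function with viability constant $a$ and capacity $K$ is a nondecreasing $f:\mathbb{N}_0\to\mathbb{N}_0$ with $f(0)=0$, $f(a)=a$, $f(K)=K$, $f(u)\in[0,u)_{\mathbb{Z}}$ for $u\in(0,a)_{\mathbb{Z}}$, $f(u)\in(u,K]_{\mathbb{Z}}$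 for $u\in(a,K)_{\mathbb{Z}}$, and $f(u)\in[K,u)_{\mathbb{Z}}$ for $u\in(K,\infty)_{\mathbb{Z}}$. The bistable reaction-diffusion cellular automaton determined by $\delta$ and $f$ is $u(t+1)=F(u(t))$, $t\in\mathbb{N}_0$, where for $u\in\mathbb{N}_0^{\mathbb{Z}}$, $n\in\mathbb{Z}$, $$F(u)_n=f(u_n)+h_\delta(f(u_{n-1}),f(u_n))+h_\delta(f(u_{n+1}),f(u_n)).$$ A wave profile is a sequence $w=(w_n)_{n\in\mathbb{Z}}$ of nonnegative integers for which there is $N\in\mathbb{N}$ with $w_n=0$ for $n\le 0$, $w_n=K$ for $n\ge N$, and $0=w_0<w_1\le w_2\le\dots\le w_{N-1}<w_N=K$. *)

theory Defs
  imports Main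
begin

(* For 2*j <= |m - n| <= 2*j + 1 with 0 <= j < \<delta> the value has modulus j = |m - n| div 2
   and the sign of m - n; the lemmas below are the defining clauses with explicit j. *)
definition h :: "nat \<Rightarrow> nat \<Rightarrow> nat \<Rightarrow> int" where
  "h \<delta> m n =
    (if int m - int n \<ge> 2 * int \<delta> then int \<delta>
     else if int m - int n \<le> - 2 * int \<delta> then - int \<delta>
     else if m \<ge> n then (int m - int n) div 2
     else - ((int n - int m) div 2))"

lemma h_upper: "int m - int n \<ge> 2 * int \<delta> \<Longrightarrow> h \<delta> m n = int \<delta>"
  by (simp add: h_def)

lemma h_lower: "int m - int n \<le> - 2 * int \<delta> \<Longrightarrow> h \<delta> m n = - int \<delta>"
  by (simp add: h_def)

lemma h_pos:
  assumes "j \<in> {1..int \<delta> - 1}" "int m - int n \<in> {2 * j, 2 * j + 1}"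
  shows "h \<delta> m n = j"
  using assms by (auto simp: h_def)

lemma h_neg:
  assumes "j \<in> {1..int \<delta> - 1}" "int n - int m \<in> {2 * j, 2 * j + 1}"
  shows "h \<delta> m n = - j"
  using assms by (auto simp: h_def)

lemma h_zero:
  assumes "\<not> int m - int n \<ge> 2 * int \<delta>" "\<not> int m - int n \<le> - 2 * int \<delta>"
    and "\<And>j. j \<in> {1..int \<delta> - 1} \<Longrightarrow>
      int m - int n \<notin> {2 * j, 2 * j + 1} \<and> int n - int m \<notin> {2 * j, 2 * j + 1}"
  shows "h \<delta> m n = 0"
proof -
  define d where "d = int m - int n"
  have "d < 2" using assms(1) assms(3)[of "d div 2"] unfolding d_def by auto presburger
  moreover have "- d < 2" using assms(2) assms(3)[of "(- d) div 2"] unfolding d_def by auto presburger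
  ultimately show ?thesis using assms(1,2) unfolding h_def d_def by auto
qed

definition bistable_reaction :: "nat \<Rightarrow> nat \<Rightarrow> (nat \<Rightarrow> nat) \<Rightarrow> bool" where
  "bistable_reaction a K f \<longleftrightarrow>
     mono f \<and> f 0 = 0 \<and> f a = a \<and> f K = K \<and>
     (\<forall>u \<in> {0<..<a}. f u \<in> {0..<u}) \<and>
     (\<forall>u \<in> {a<..<K}. f u \<in> {u<..K}) \<and>
     (\<forall>u \<in> {K<..}. f u \<in> {K..<u})"

(* Integer-valued, so that no truncated subtraction occurs; the values are in fact
   nonnegative, see ca_update_nonneg. *)
definition ca_update :: "nat \<Rightarrow> (nat \<Rightarrow> nat) \<Rightarrow> (int \<Rightarrow> nat) \<Rightarrow> int \<Rightarrow> int" where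
  "ca_update \<delta> f u n =
     int (f (u n)) + h \<delta> (f (u (n - 1))) (f (u n)) + h \<delta> (f (u (n + 1))) (f (u n))"

lemma ca_update_nonneg: "ca_update \<delta> f u n \<ge> 0"
proof -
  have *: "int m + 2 * h \<delta> k m \<ge> 0" for k m
    by (auto simp: h_def)
  from *[of "f (u n)" "f (u (n - 1))"] *[of "f (u n)" "f (u (n + 1))"]
  show ?thesis by (simp add: ca_update_def)
qed

definition wave_profile :: "nat \<Rightarrow> (int \<Rightarrow> nat) \<Rightarrow> bool" where
  "wave_profile K w \<longleftrightarrow>
     (\<exists>N::int. N \<ge> 1 \<and> (\<forall>n \<le> 0. w n = 0) \<and> (\<forall>n \<ge> N. w n = K) \<and>
        w 0 < w 1 \<and> (\<forall>n. 1 \<le> n \<and> n < N - 1 \<longrightarrow> w n \<le> w (n + 1)) \<and> w (N - 1) < w N)"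

end

theory Submission
  imports Defs
begin

text \<open>
  For \<open>\<delta> = 1\<close> the flux between neighbouring cells is at most one, and it vanishes unless the
  values after reaction differ by at least two. On the other hand the reaction is rigid next to the
  two stable states: it sends \<open>1\<close> to \<open>0\<close> and \<open>K - 1\<close> to \<open>K\<close>. A front moving left would have to
  create its first positive value \<open>w 1\<close> in a cell that holds \<open>0\<close>, out of the single unit of flux
  that this cell can receive from its right neighbour. So \<open>w 1 = 1\<close>; but the right neighbour holds
  \<open>0\<close> or, if the front moves by one cell, \<open>w 1\<close>, and either way the reaction empties it. A front
  moving right fails in the same way at its other end, where the value \<open>w (N - 1) < K\<close> would have
  to be created in a cell at capacity. The same rigidity makes \<open>0, 1, a, K - 1, K\<close> a
  pinned wave: the reaction turns it into \<open>0, 0, a, K, K\<close>, whose only jumps, each of size at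
  least two, are the two at the cell with value \<open>a\<close>, and one unit across each of them restores the
  profile.
\<close>

lemma h_1:
  "h (Suc 0) m n = (if int m - int n \<ge> 2 then 1 else if int m - int n \<le> - 2 then - 1 else 0)"
  by (auto simp: h_def)

lemma reaction_one_eq_zero:
  assumes "bistable_reaction a K f" and "2 \<le> a"
  shows "f 1 = 0"
  using assms by (fastforce simp: bistable_reaction_def)

lemma reaction_pred_capacity:
  assumes "bistable_reaction a K f" and "a + 2 \<le> K"
  shows "f (K - 1) = K"
proof -
  have "K - 1 \<in> {a<..<K}"
    using assms(2) by auto
  then have "f (K - 1) \<in> {K - 1<..K}"
    using assms(1) unfolding bistable_reaction_def by blast
  then show ?thesis by auto
qed

text \<open>
  In the cell \<open>1 + c\<close> the front has to lift \<open>0\<close> to \<open>w 1 = 1\<close>, and for this its right neighbour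
  would need at least \<open>2\<close> after the reaction, where it has \<open>0\<close>.
\<close>

lemma no_left_moving_wave:
  assumes f0: "f 0 = 0" and f1: "f 1 = 0"
    and zero: "\<forall>n \<le> 0. w n = 0" and pos: "0 < w 1"
    and wave: "\<forall>n. ca_update 1 f w n = int (w (n - c))"
  shows "c \<ge> 0"
proof (rule ccontr)
  assume "\<not> c \<ge> 0"
  then have c: "c \<le> - 1" by simp
  have "ca_update 1 f w (1 + c) = int (w 1)"
    using wave by simp
  moreover have "w (1 + c) = 0" and "w (1 + c - 1) = 0"
    using c zero by auto
  ultimately have flux: "h 1 (f (w (2 + c))) 0 = int (w 1)"
    by (simp add: ca_update_def f0 h_1 algebra_simps)
  with pos have "w 1 = 1" and big: "f (w (2 + c)) \<ge> 2"
    by (auto simp: h_1 split: if_splits)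
  moreover have "w (2 + c) = 0 \<or> w (2 + c) = w 1"
    using c zero by (cases "c = - 1") auto
  ultimately show False
    using f0 f1 by auto
qed

text \<open>
  The counterpart at capacity: the cell \<open>N - 1 + c\<close> has to lose one unit to its left neighbour,
  which the reaction has already filled to \<open>K\<close>.
\<close>

lemma no_right_moving_wave:
  assumes fK: "f K = K" and fK1: "f (K - 1) = K"
    and cap: "\<forall>n \<ge> N. w n = K" and below: "w (N - 1) < K"
    and wave: "\<forall>n. ca_update 1 f w n = int (w (n - c))"
  shows "c \<le> 0"
proof (rule ccontr)
  assume "\<not> c \<le> 0"
  then have c: "c \<ge> 1" by simp
  have "ca_update 1 f w (N - 1 + c) = int (w (N - 1))"
    using wave by simp
  moreover have "w (N - 1 + c) = K" and "w (N - 1 + c + 1) = K"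
    using c cap by auto
  ultimately have flux: "int K + h 1 (f (w (N - 2 + c))) K = int (w (N - 1))"
    by (auto simp: ca_update_def fK h_1 algebra_simps split: if_splits)
  with below have "w (N - 1) = K - 1" and "f (w (N - 2 + c)) \<noteq> K"
    by (auto simp: h_1 split: if_splits)
  moreover have "w (N - 2 + c) = K \<or> w (N - 2 + c) = w (N - 1)"
    using c cap by (cases "c = 1") auto
  ultimately show False
    using fK fK1 by auto
qed

text \<open>
  The value \<open>a\<close> in the middle is fixed by the reaction and at distance at least two from both \<open>0\<close>
  and \<open>K\<close>, so it gains one unit from the right and loses one to the left. These units make up for
  what the reaction adds at \<open>K - 1\<close> and removes at \<open>1\<close>.
\<close>

definition pinned_profile :: "nat \<Rightarrow> nat \<Rightarrow> int \<Rightarrow> nat" where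
  "pinned_profile a K n =
     (if n \<le> 0 then 0 else if n = 1 then 1 else if n = 2 then a else if n = 3 then K - 1 else K)"

lemma wave_profile_pinned_profile:
  assumes "2 \<le> a" and "a + 2 \<le> K"
  shows "wave_profile K (pinned_profile a K)"
  unfolding wave_profile_def
  by (rule exI[of _ 4]) (use assms in \<open>auto simp: pinned_profile_def\<close>)

lemma ca_update_pinned_profile:
  assumes a: "2 \<le> a" "a + 2 \<le> K"
    and f: "f 0 = 0" "f 1 = 0" "f a = a" "f (K - 1) = K" "f K = K"
  shows "ca_update 1 f (pinned_profile a K) n = int (pinned_profile a K n)"
proof -
  consider "n \<le> 0" | "n = 1" | "n = 2" | "n = 3" | "n \<ge> 4" by linarith
  then show ?thesis
    by cases (use a f in \<open>auto simp: ca_update_def h_1 pinned_profile_def\<close>)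
qed

theorem lemma4p2:
  fixes \<delta> a K :: nat and f :: "nat \<Rightarrow> nat"
  assumes "2 \<le> a" and "a + 2 \<le> K"
    and "bistable_reaction a K f"
    and "\<delta> = 1"
  shows "(\<nexists>w c. wave_profile K w \<and> c \<noteq> 0 \<and> (\<forall>n. ca_update \<delta> f w n = int (w (n - c))))
       \<and> (\<exists>w. wave_profile K w \<and> (\<forall>n. ca_update \<delta> f w n = int (w n)))"
proof
  have f: "f 0 = 0" "f a = a" "f K = K"
    using assms(3) by (auto simp: bistable_reaction_def)
  note f1 = reaction_one_eq_zero[OF assms(3,1)]
  note fK1 = reaction_pred_capacity[OF assms(3,2)]
  show "\<nexists>w c. wave_profile K w \<and> c \<noteq> 0 \<and> (\<forall>n. ca_update \<delta> f w n = int (w (n - c)))"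
  proof (rule notI, elim exE conjE)
    fix w :: "int \<Rightarrow> nat" and c :: int
    assume profile: "wave_profile K w" and c: "c \<noteq> 0"
      and "\<forall>n. ca_update \<delta> f w n = int (w (n - c))"
    then have wave: "\<forall>n. ca_update 1 f w n = int (w (n - c))"
      using assms(4) by simp
    from profile obtain N where N: "\<forall>n \<le> 0. w n = 0" "\<forall>n \<ge> N. w n = K" "w 0 < w 1"
        "w (N - 1) < w N"
      unfolding wave_profile_def by blast
    have "0 < w 1" and "w (N - 1) < K"
      using N by auto
    with no_left_moving_wave[OF f(1) f1 N(1) _ wave] no_right_moving_wave[OF f(3) fK1 N(2) _ wave]
    show False using c by simp
  qed
  show "\<exists>w. wave_profile K w \<and> (\<forall>n. ca_update \<delta> f w n = int (w n))"
    using wave_profile_pinned_profile[OF assms(1,2)]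
      ca_update_pinned_profile[OF assms(1,2) f(1) f1 f(2) fK1 f(3)] assms(4)
    by blast
qed

end
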